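(* Let $(\widehat X_i)_{i\ge 1}$ be independent (not necessarily identically distributed) random variables with values in $\mathbb{N}_0=\{0,1,2,\dots\}$, with probability mass functions $\widehat f_i(k)=P(\widehat X_i=k)$ and cumulative distribution functions $\widehat F_i(x)=P(\widehat X_i\le x)$. For $n\ge 1$ let $\widehat Y_n=\sum_{i=1}^n\widehat X_i$, $\widehat Z_n=\max_{1\le i\le n}\widehat X_i$, and $\widehat G_n(y,z)=P(\widehat Y_n\le y,\ \widehat Z_n\le z)$. Then for all integers $n\ge 2$ and all $(y,z)\in\mathbb{R}_+^2$ (where $\mathbb{R}_+=[0,\infty)$), $$\widehat G_n(y,z)=\sum_{k=0}^{\lfloor z\rfloor}\widehat G_{n-1}(y-k,z)\,\widehat f_n(k)=\sum_{k=0}^{\min(\lfloor y\rfloor,\lfloor z\rfloor)}\widehat G_{n-1}(y-k,z)\,\widehat f_n(k),$$ with initial condition $$\widehat G_1(y,z)=\widehat F_1(\min(y,z)),\qquad\forall (y,z)\in\mathbb{R}_+^2.$$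
   Context: $\widehat G_n(y,z)=0$ whenever $y<0$ or $z<0$. *)

theory Defs
  imports "HOL-Probability.Probability"
begin

text \<open>
  Throughout, \<open>X i\<close> is a random variable on \<open>M\<close> with values in \<open>nat\<close>; only the
  indices \<open>i \<ge> 1\<close> are used.
\<close>

definition mass_fun :: "'a measure \<Rightarrow> (nat \<Rightarrow> 'a \<Rightarrow> nat) \<Rightarrow> nat \<Rightarrow> nat \<Rightarrow> real" where
  "mass_fun M X i k = measure M {\<omega> \<in> space M. X i \<omega> = k}"

definition dist_fun :: "'a measure \<Rightarrow> (nat \<Rightarrow> 'a \<Rightarrow> nat) \<Rightarrow> nat \<Rightarrow> real \<Rightarrow> real" where
  "dist_fun M X i x = measure M {\<omega> \<in> space M. real (X i \<omega>) \<le> x}"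

definition partial_sum :: "(nat \<Rightarrow> 'a \<Rightarrow> nat) \<Rightarrow> nat \<Rightarrow> 'a \<Rightarrow> nat" where
  "partial_sum X n \<omega> = (\<Sum>i = 1..n. X i \<omega>)"

definition partial_max :: "(nat \<Rightarrow> 'a \<Rightarrow> nat) \<Rightarrow> nat \<Rightarrow> 'a \<Rightarrow> nat" where
  "partial_max X n \<omega> = (MAX i\<in>{1..n}. X i \<omega>)"

definition joint_dist :: "'a measure \<Rightarrow> (nat \<Rightarrow> 'a \<Rightarrow> nat) \<Rightarrow> nat \<Rightarrow> real \<Rightarrow> real \<Rightarrow> real" where
  "joint_dist M X n y z =
     measure M {\<omega> \<in> space M. real (partial_sum X n \<omega>) \<le> y \<and> real (partial_max X n \<omega>) \<le> z}"

text \<open>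
  The convention that the joint distribution function vanishes as soon as one argument is
  negative needs no case distinction in the definition.
\<close>

lemma joint_dist_neg:
  assumes "y < 0 \<or> z < 0"
  shows "joint_dist M X n y z = 0"
proof -
  have "\<not> (real (partial_sum X n \<omega>) \<le> y \<and> real (partial_max X n \<omega>) \<le> z)" for \<omega>
    using assms of_nat_0_le_iff[of "partial_sum X n \<omega>", where ?'a = real]
      of_nat_0_le_iff[of "partial_max X n \<omega>", where ?'a = real] by linarith
  then have "{\<omega> \<in> space M. real (partial_sum X n \<omega>) \<le> y \<and> real (partial_max X n \<omega>) \<le> z} = {}"
    by blast
  then show ?thesis
    unfolding joint_dist_def by (simp only: measure_empty)
qed

end

theory Submission
  imports Defs
begin

text \<open>
  Conditioning on the value \<open>k\<close> of the last variable: on \<open>X n = k\<close> the event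
  \<open>Y\<^sub>n \<le> y, Z\<^sub>n \<le> z\<close> becomes \<open>Y\<^bsub>n-1\<^esub> \<le> y - k, Z\<^bsub>n-1\<^esub> \<le> z\<close> if \<open>k \<le> z\<close> and is empty otherwise, and the
  first \<open>n - 1\<close> variables are independent of \<open>X n\<close>. Terms with \<open>k > y\<close> vanish.
\<close>

text \<open>Trades the maximum for a finite conjunction, which splits at the last index and is
  visibly measurable. The bound \<open>n \<ge> 1\<close> is there because \<open>Max\<close> of the
  empty set is unspecified.\<close>

lemma partial_max_le_iff:
  assumes "n \<ge> 1"
  shows "real (partial_max X n \<omega>) \<le> z \<longleftrightarrow> (\<forall>i\<in>{1..n}. real (X i \<omega>) \<le> z)"
proof
  assume "real (partial_max X n \<omega>) \<le> z"
  moreover have "X i \<omega> \<le> partial_max X n \<omega>" if "i \<in> {1..n}" for i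
    unfolding partial_max_def using that by (intro Max_ge) auto
  ultimately show "\<forall>i\<in>{1..n}. real (X i \<omega>) \<le> z"
    by (meson of_nat_mono order_trans)
next
  assume "\<forall>i\<in>{1..n}. real (X i \<omega>) \<le> z"
  moreover have "partial_max X n \<omega> \<in> (\<lambda>i. X i \<omega>) ` {1..n}"
    unfolding partial_max_def using assms by (intro Max_in) auto
  ultimately show "real (partial_max X n \<omega>) \<le> z"
    by auto
qed

text \<open>The pointwise core of the recursion: with the last value fixed, it moves to the right of
  the sum bound and contributes one conjunct to the maximum bound.\<close>

lemma joint_event_Suc_iff:
  assumes "m \<ge> 1" "X (Suc m) \<omega> = k"
  shows "real (partial_sum X (Suc m) \<omega>) \<le> y \<and> real (partial_max X (Suc m) \<omega>) \<le> z \<longleftrightarrow>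
    real (partial_sum X m \<omega>) \<le> y - real k \<and> real (partial_max X m \<omega>) \<le> z \<and> real k \<le> z"
  using assms
  by (auto simp: partial_max_le_iff partial_sum_def atLeastAtMostSuc_conv algebra_simps)

text \<open>The first event is a function of the block \<open>X 1, ..., X m\<close> alone, and
  disjoint blocks of an independent family are independent, so the probability factors.\<close>

lemma (in prob_space) prob_joint_event_and_next:
  fixes X :: "nat \<Rightarrow> 'a \<Rightarrow> nat"
  assumes indep: "indep_vars (\<lambda>_. count_space UNIV) X {1..}" and m: "m \<ge> 1"
  shows "prob {\<omega> \<in> space M. (real (partial_sum X m \<omega>) \<le> y \<and> real (partial_max X m \<omega>) \<le> z) \<and>
      X (Suc m) \<omega> = k} = joint_dist M X m y z * mass_fun M X (Suc m) k"
proof -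
  define C where "C = (\<lambda>_::nat. count_space (UNIV :: nat set))"
  \<comment> \<open>Both events become predicates on coordinate tuples, so that they can be composed
    with the restricted families.\<close>
  define f where "f = (\<lambda>x. real (\<Sum>i = 1..m. x i) \<le> y \<and> (\<forall>i\<in>{1..m}. real (x i) \<le> z))"
  define g where "g = (\<lambda>x :: nat \<Rightarrow> nat. x (Suc m) = k)"
  have "indep_var (PiM {1..m} C) (\<lambda>\<omega>. restrict (\<lambda>i. X i \<omega>) {1..m})
      (PiM {Suc m} C) (\<lambda>\<omega>. restrict (\<lambda>i. X i \<omega>) {Suc m})"
    unfolding C_def by (rule indep_var_restrict[OF indep]) auto
  moreover have "f \<in> measurable (PiM {1..m} C) (count_space UNIV)"
  proof -
    have comp: "(\<lambda>x. real (x i)) \<in> borel_measurable (PiM {1..m} C)" if "i \<in> {1..m}" for i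
      using measurable_compose[OF measurable_component_singleton[OF that, of C],
          of real borel] by (simp add: C_def)
    have [measurable]: "(\<lambda>x. \<Sum>i = 1..m. real (x i)) \<in> borel_measurable (PiM {1..m} C)"
      by (rule borel_measurable_sum) (rule comp)
    have [measurable]: "Measurable.pred (PiM {1..m} C) (\<lambda>x. \<forall>i\<in>{1..m}. real (x i) \<le> z)"
    proof (rule pred_intros_finite)
      fix i assume "i \<in> {1..m}"
      from comp[OF this] show "Measurable.pred (PiM {1..m} C) (\<lambda>x. real (x i) \<le> z)"
        by simp
    qed simp
    show ?thesis
      unfolding f_def of_nat_sum by measurable
  qed
  moreover have "g \<in> measurable (PiM {Suc m} C) (count_space UNIV)"
    unfolding g_def
    using measurable_compose[OF measurable_component_singleton[of "Suc m" "{Suc m}" C],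
        of "\<lambda>j. j = k" "count_space UNIV"] by (simp add: C_def)
  ultimately have "indep_var (count_space UNIV) (f \<circ> (\<lambda>\<omega>. restrict (\<lambda>i. X i \<omega>) {1..m}))
      (count_space UNIV) (g \<circ> (\<lambda>\<omega>. restrict (\<lambda>i. X i \<omega>) {Suc m}))"
    by (rule indep_var_compose)
  \<comment> \<open>The preimages of \<open>{True}\<close> under the two Boolean variables are the
    events themselves.\<close>
  from indep_varD[OF this, of "{True}" "{True}"]
  have "prob {\<omega> \<in> space M. f (restrict (\<lambda>i. X i \<omega>) {1..m}) \<and> X (Suc m) \<omega> = k} =
      prob {\<omega> \<in> space M. f (restrict (\<lambda>i. X i \<omega>) {1..m})} *
      prob {\<omega> \<in> space M. X (Suc m) \<omega> = k}"
    by (simp add: vimage_def Int_def g_def conj_commute)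
  \<comment> \<open>\<open>f\<close> reads only coordinates in \<open>{1..m}\<close>, where
    \<open>restrict\<close> changes nothing.\<close>
  moreover have "f (restrict (\<lambda>i. X i \<omega>) {1..m}) \<longleftrightarrow>
      real (partial_sum X m \<omega>) \<le> y \<and> real (partial_max X m \<omega>) \<le> z" for \<omega>
    using m by (auto simp: f_def partial_max_le_iff partial_sum_def)
  ultimately show ?thesis
    by (simp add: joint_dist_def mass_fun_def)
qed

lemma (in prob_space) joint_dist_Suc:
  fixes X :: "nat \<Rightarrow> 'a \<Rightarrow> nat"
  assumes indep: "indep_vars (\<lambda>_. count_space UNIV) X {1..}" and m: "m \<ge> 1" and z: "z \<ge> 0"
  shows "joint_dist M X (Suc m) y z =
    (\<Sum>k = 0..nat \<lfloor>z\<rfloor>. joint_dist M X m (y - real k) z * mass_fun M X (Suc m) k)"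
proof -
  \<comment> \<open>The last variable enters \<open>E k\<close> only through its value; the sum
    bound is already shifted to \<open>y - real k\<close>, the form to which the product rule
    applies.\<close>
  define E where "E = (\<lambda>k. {\<omega> \<in> space M. (real (partial_sum X m \<omega>) \<le> y - real k \<and>
      real (partial_max X m \<omega>) \<le> z) \<and> X (Suc m) \<omega> = k})"
  have X_meas: "random_variable (count_space UNIV) (X i)" if "i \<ge> 1" for i
    using indep that unfolding indep_vars_def by simp
  have E_sets: "E k \<in> events" for k
  proof -
    have real_X: "(\<lambda>\<omega>. real (X i \<omega>)) \<in> borel_measurable M" if "i \<in> {1..m}" for i
      using measurable_compose[OF X_meas, of i real borel] that by simp
    have "(\<lambda>\<omega>. \<Sum>i = 1..m. real (X i \<omega>)) \<in> borel_measurable M"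
      by (rule borel_measurable_sum) (rule real_X)
    then have [measurable]: "(\<lambda>\<omega>. real (partial_sum X m \<omega>)) \<in> borel_measurable M"
      by (simp add: partial_sum_def)
    have [measurable]: "random_variable (count_space UNIV) (X (Suc m))"
      by (rule X_meas) simp
    have "Measurable.pred M (\<lambda>\<omega>. \<forall>i\<in>{1..m}. real (X i \<omega>) \<le> z)"
    proof (rule pred_intros_finite)
      fix i assume "i \<in> {1..m}"
      from real_X[OF this] show "Measurable.pred M (\<lambda>\<omega>. real (X i \<omega>) \<le> z)"
        by simp
    qed simp
    then have [measurable]: "Measurable.pred M (\<lambda>\<omega>. real (partial_max X m \<omega>) \<le> z)"
      using m by (simp add: partial_max_le_iff)
    show ?thesis
      unfolding E_def by measurable
  qed
  \<comment> \<open>Here \<open>z \<ge> 0\<close> matters: for negative \<open>z\<close>,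
    \<open>nat\<close> would return 0 and the range would still contain
    \<open>k = 0\<close>.\<close>
  have le_z: "real k \<le> z \<longleftrightarrow> k \<in> {0..nat \<lfloor>z\<rfloor>}" for k
    using z by (auto simp: le_nat_iff le_floor_iff)
  have "joint_dist M X (Suc m) y z = prob (\<Union>k\<in>{0..nat \<lfloor>z\<rfloor>}. E k)"
    unfolding joint_dist_def
  proof (rule arg_cong[where f = prob], rule set_eqI)
    fix \<omega>
    show "\<omega> \<in> {\<omega> \<in> space M. real (partial_sum X (Suc m) \<omega>) \<le> y \<and>
        real (partial_max X (Suc m) \<omega>) \<le> z} \<longleftrightarrow> \<omega> \<in> (\<Union>k\<in>{0..nat \<lfloor>z\<rfloor>}. E k)"
      \<comment> \<open>A point can lie only in the \<open>E k\<close> whose index is the value of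
        \<open>X (Suc m)\<close> there, so that value is the witness; this also makes the union
        disjoint.\<close>
      using joint_event_Suc_iff[OF m refl, of X \<omega> y z] le_z[of "X (Suc m) \<omega>"]
      by (auto simp: E_def)
  qed
  also have "\<dots> = (\<Sum>k = 0..nat \<lfloor>z\<rfloor>. prob (E k))"
    using E_sets by (intro finite_measure_finite_Union) (auto simp: disjoint_family_on_def E_def)
  also have "\<dots> = (\<Sum>k = 0..nat \<lfloor>z\<rfloor>. joint_dist M X m (y - real k) z * mass_fun M X (Suc m) k)"
    unfolding E_def using prob_joint_event_and_next[OF indep m] by simp
  finally show ?thesis .
qed

text \<open>The dropped terms have a negative first argument, so their \<open>joint_dist\<close>
  factor is zero whatever the weights \<open>p\<close>.\<close>

lemma joint_dist_sum_truncate: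
  assumes "y \<ge> 0" "z \<ge> 0"
  shows "(\<Sum>k = 0..nat \<lfloor>z\<rfloor>. joint_dist M X m (y - real k) z * p k) =
    (\<Sum>k = 0..nat (min \<lfloor>y\<rfloor> \<lfloor>z\<rfloor>). joint_dist M X m (y - real k) z * p k)"
proof (rule sum.mono_neutral_right)
  show "\<forall>k\<in>{0..nat \<lfloor>z\<rfloor>} - {0..nat (min \<lfloor>y\<rfloor> \<lfloor>z\<rfloor>)}. joint_dist M X m (y - real k) z * p k = 0"
  proof
    fix k assume "k \<in> {0..nat \<lfloor>z\<rfloor>} - {0..nat (min \<lfloor>y\<rfloor> \<lfloor>z\<rfloor>)}"
    then have "\<lfloor>y\<rfloor> < int k"
      \<comment> \<open>Since \<open>k\<close> is at most \<open>\<lfloor>z\<rfloor>\<close>, it can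
        exceed the minimum only by exceeding \<open>\<lfloor>y\<rfloor>\<close>.\<close>
      using assms by auto
    then have "y - real k < 0"
      by linarith
    then show "joint_dist M X m (y - real k) z * p k = 0"
      by (simp add: joint_dist_neg)
  qed
qed (use assms in auto)

text \<open>A single variable is both its own sum and its own maximum, so the two bounds merge into
  their minimum.\<close>

lemma joint_dist_1: "joint_dist M X 1 y z = dist_fun M X 1 (min y z)"
  by (simp add: joint_dist_def dist_fun_def partial_sum_def partial_max_def)

theorem theorem3p1:
  fixes M :: "'a measure" and X :: "nat \<Rightarrow> 'a \<Rightarrow> nat"
  assumes "prob_space M"
    and "prob_space.indep_vars M (\<lambda>_. count_space UNIV) X {1..}"
  shows "(\<forall>n\<ge>2. \<forall>y\<ge>0. \<forall>z\<ge>0.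
            joint_dist M X n y z =
              (\<Sum>k = 0..nat \<lfloor>z\<rfloor>. joint_dist M X (n - 1) (y - real k) z * mass_fun M X n k) \<and>
            joint_dist M X n y z =
              (\<Sum>k = 0..nat (min \<lfloor>y\<rfloor> \<lfloor>z\<rfloor>). joint_dist M X (n - 1) (y - real k) z * mass_fun M X n k)) \<and>
         (\<forall>y\<ge>0. \<forall>z\<ge>0. joint_dist M X 1 y z = dist_fun M X 1 (min y z))"
proof (intro conjI allI impI)
  fix n :: nat and y z :: real
  assume n: "n \<ge> 2" and y: "y \<ge> 0" and z: "z \<ge> 0"
  have "n - 1 \<ge> 1" "Suc (n - 1) = n"
    using n by auto
  then show rec: "joint_dist M X n y z =
      (\<Sum>k = 0..nat \<lfloor>z\<rfloor>. joint_dist M X (n - 1) (y - real k) z * mass_fun M X n k)"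
    using prob_space.joint_dist_Suc[OF assms, of "n - 1" z y] z by simp
  show "joint_dist M X n y z =
      (\<Sum>k = 0..nat (min \<lfloor>y\<rfloor> \<lfloor>z\<rfloor>). joint_dist M X (n - 1) (y - real k) z * mass_fun M X n k)"
    unfolding rec by (rule joint_dist_sum_truncate[OF y z])
qed (rule joint_dist_1)

end
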